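(* For every integer $k\ge 0$ and every $x$ with $0<|x|<1$, $$\operatorname{Li}_{k+1}(x)=\sum_{n=k}^{\infty}\begin{bmatrix} n\\ k\end{bmatrix}\frac{1}{x^n}\left\{P_n(x)+\frac{(-1)^{n-1}}{n!}(1-x)^n\ln(1-x)\right\},$$ where $P_n(x)$ is the polynomial $$P_n(x)=\frac{1}{n!}\left(H_n(x-1)^n+\sum_{j=0}^{n-1}\binom{n}{j}\frac{(x-1)^j}{n-j}\right).$$
   Context: $\begin{bmatrix} n\\ k\end{bmatrix}$ denotes the unsigned Stirling numbers of the first kind, defined by $x(x+1)\cdots(x+n-1)=\sum_{k=0}^{n}\begin{bmatrix} n\\ k\end{bmatrix}x^k$ (so $\begin{bmatrix} 0\\ 0\end{bmatrix}=1$). The polylogarithm is $\operatorname{Li}_s(x)=\sum_{n=1}^{\infty}\frac{x^n}{n^s}$. $H_n=1+\frac12+\cdots+\frac1n$ are the harmonic numbers, with $H_0=0$. Empty sums are $0$, and $\ln$ is the principal branch of the logarithm. *)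

theory Defs
  imports "HOL-Complex_Analysis.Complex_Analysis" "HOL-Combinatorics.Stirling"
begin

text \<open>
  The unsigned Stirling numbers of the first kind are the library's \<^const>\<open>stirling\<close>. The library
  defines them by their recurrence; the following is their generating function.
\<close>

lemma stirling_generating_function:
  fixes x :: "'a :: comm_semiring_1"
  shows "pochhammer x n = (\<Sum>k\<le>n. of_nat (stirling n k) * x ^ k)"
  by (rule stirling_pochhammer [symmetric])

definition polylog :: "complex \<Rightarrow> complex \<Rightarrow> complex" where
  "polylog s x = (\<Sum>n. x ^ Suc n / of_nat (Suc n) powr s)"

definition P :: "nat \<Rightarrow> complex \<Rightarrow> complex" where
  "P n x = 1 / fact n *
     (harm n * (x - 1) ^ n + (\<Sum>j<n. of_nat (n choose j) * ((x - 1) ^ j / of_nat (n - j))))"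

end

theory Submission
  imports Defs
begin

text \<open>
  Write \<open>R\<^sub>n(x)\<close> for the sum of \<open>P\<^sub>n(x)\<close> and the logarithmic term, \<open>(y)\<^sub>n\<close> for the rising factorial
  and \<open>[n,k]\<close> for the unsigned Stirling numbers. The function \<open>R\<^sub>n\<close> is the \<open>n\<close>-fold integral
  from \<open>0\<close> of \<open>- ln(1 - x) = \<Sum>\<^sub>m x\<^sup>m / m\<close>, where \<open>m \<ge> 1\<close>, so that
  \<open>R\<^sub>n(x) / x\<^sup>n = \<Sum>\<^sub>m x\<^sup>m / (m)\<^sub>n\<^sub>+\<^sub>1\<close> (\<open>log_remainder_sums\<close>). On the other hand, inverse powers
  expand in reciprocal rising factorials with Stirling coefficients,
  \<open>1 / m\<^sup>k\<^sup>+\<^sup>1 = \<Sum>\<^sub>n [n,k] / (m)\<^sub>n\<^sub>+\<^sub>1\<close> (\<open>stirling_over_pochhammer_sums\<close>). Both sides of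
  the theorem are therefore iterated sums of the double series
  \<open>\<Sum>\<^sub>m\<^sub>,\<^sub>n [n,k] x\<^sup>m / (m)\<^sub>n\<^sub>+\<^sub>1\<close>. Replacing \<open>x\<close> by \<open>|x|\<close> makes all its terms
  nonnegative, and summing first over \<open>n\<close> gives \<open>Li\<^sub>k\<^sub>+\<^sub>1(|x|) < \<infinity>\<close>; hence the double series
  converges absolutely and the order of summation is immaterial.

  The expansion of \<open>R\<^sub>n\<close> is obtained without integration: \<open>R\<^sub>n\<close> and \<open>x\<^sup>n\<close>
  times the series satisfy the same first-order recurrence \<open>n R\<^sub>n = (x - 1) R\<^sub>n\<^sub>-\<^sub>1 + x\<^sup>n / n!\<close> with the same initial value.
\<close>

section \<open>Inverse powers as series of reciprocal rising factorials\<close>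

text \<open>
  The recurrence \<open>[n+1,k+1] = n [n,k+1] + [n,k]\<close>, with \<open>n\<close> written as \<open>(y + n) - y\<close>, turns the
  summand on the left into \<open>y\<close> times the summand on the right plus a telescoping difference.
\<close>

lemma sum_stirling_over_pochhammer:
  fixes y :: real
  assumes "y > 0"
  shows "(\<Sum>n<N. of_nat (stirling n k) / pochhammer y (Suc n)) =
         y * (\<Sum>n<N. of_nat (stirling n (Suc k)) / pochhammer y (Suc n)) +
         of_nat (stirling N (Suc k)) / pochhammer y N"
proof (induction N)
  case (Suc N)
  have nz: "pochhammer y N \<noteq> 0" "y + real N \<noteq> 0"
    using pochhammer_pos[OF assms, of N] assms by auto
  have "of_nat (stirling N (Suc k)) / pochhammer y N + of_nat (stirling N k) / pochhammer y (Suc N)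
      = y * (of_nat (stirling N (Suc k)) / pochhammer y (Suc N))
        + of_nat (stirling (Suc N) (Suc k)) / pochhammer y (Suc N)"
  proof -
    have "A / p + B / (p * q) = (q - r) * (A / (p * q)) + (r * A + B) / (p * q)"
      if "p \<noteq> 0" "q \<noteq> 0" for A B p q r :: real
      using that by (simp add: field_simps)
    from this[OF nz, of "of_nat (stirling N (Suc k))" "of_nat (stirling N k)" "real N"] show ?thesis
      by (simp add: pochhammer_Suc)
  qed
  then show ?case
    using Suc.IH by (simp add: algebra_simps)
qed simp

text \<open>
  A positive limit would make the summable terms eventually at least a multiple of \<open>1 / n\<close>.
  This disposes of the boundary term of the telescoping sum above without an estimate for the
  growth of the Stirling numbers.
\<close>

lemma tendsto_0_if_summable_over_linear:
  fixes c :: "nat \<Rightarrow> real"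
  assumes "c \<longlonglongrightarrow> L" and "\<And>n. c n \<ge> 0" and "y > 0" and "summable (\<lambda>n. c n / (y + real n))"
  shows "L = 0"
proof (rule ccontr)
  assume "L \<noteq> 0"
  moreover have "L \<ge> 0"
    using assms(1,2) by (meson LIMSEQ_le_const)
  ultimately have "L > 0" by simp
  define M where "M = nat \<lceil>y\<rceil>"
  have M: "y \<le> real M" unfolding M_def by linarith
  have "eventually (\<lambda>n. c n > L / 2) sequentially"
    using order_tendstoD(1)[OF assms(1), of "L / 2"] \<open>L > 0\<close> by simp
  then have "eventually (\<lambda>n. norm (inverse (real (Suc (n + M)))) \<le> 2 / L * (c n / (y + real n))) sequentially"
  proof eventually_elim
    case (elim n)
    have "inverse (real (Suc (n + M))) \<le> inverse (y + real n)"
      using M assms(3) by (intro le_imp_inverse_le) auto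
    also have "\<dots> \<le> 2 / L * c n * inverse (y + real n)"
    proof -
      have "1 \<le> 2 / L * c n"
        using elim \<open>L > 0\<close> by (simp add: field_simps)
      then have "1 * inverse (y + real n) \<le> 2 / L * c n * inverse (y + real n)"
        using assms(3) by (intro mult_right_mono) auto
      then show ?thesis by simp
    qed
    finally show ?case by (simp add: divide_inverse)
  qed
  then have "summable (\<lambda>n. inverse (real (Suc (n + M))))"
    by (rule summable_comparison_test_ev) (rule summable_mult[OF assms(4)])
  then have "summable (\<lambda>n. inverse (real n))"
    using summable_iff_shift[of "\<lambda>n. inverse (real n)" "Suc M"] by simp
  then show False
    using not_summable_harmonic[where 'a = real] by simp
qed

text \<open>
  Induction on \<open>k\<close>: in the telescoped identity every term is nonnegative, so the partial sums for
  \<open>k + 1\<close> are bounded by the sum for \<open>k\<close> divided by \<open>y\<close>, hence converge. Then the boundary term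
  converges too, and its limit can only be \<open>0\<close>; dividing by \<open>y\<close> gives the next power.
\<close>

lemma stirling_over_pochhammer_sums:
  fixes y :: real
  assumes "y > 0"
  shows "(\<lambda>n. of_nat (stirling n k) / pochhammer y (Suc n)) sums (1 / y ^ Suc k)"
proof (induction k)
  case 0
  have "(\<lambda>n. of_nat (stirling n 0) / pochhammer y (Suc n)) sums
        (\<Sum>n\<in>{0}. of_nat (stirling n 0) / pochhammer y (Suc n))"
  proof (rule sums_finite)
    fix n :: nat assume "n \<notin> {0}"
    then show "of_nat (stirling n 0) / pochhammer y (Suc n) = 0" by (cases n) auto
  qed simp
  then show ?case by simp
next
  case (Suc k)
  define a where "a = (\<lambda>n. of_nat (stirling n (Suc k)) / pochhammer y (Suc n))"
  define c where "c = (\<lambda>n. of_nat (stirling n (Suc k)) / pochhammer y n)"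
  have pos: "pochhammer y n > 0" for n by (rule pochhammer_pos[OF assms])
  have a_nonneg: "a n \<ge> 0" and c_nonneg: "c n \<ge> 0" for n
    using pos[of n] pos[of "Suc n"] by (auto simp: a_def c_def)
  have a_c: "a n = c n / (y + real n)" for n
    by (simp add: a_def c_def pochhammer_Suc)
  define s where "s = (\<lambda>N. \<Sum>n<N. of_nat (stirling n k) / pochhammer y (Suc n))"
  have s: "s N = y * (\<Sum>n<N. a n) + c N" for N
    unfolding s_def a_def c_def by (rule sum_stirling_over_pochhammer[OF assms])
  have s_lim: "s \<longlonglongrightarrow> 1 / y ^ Suc k"
    using Suc.IH by (simp add: sums_def s_def)
  have s_le: "s N \<le> 1 / y ^ Suc k" for N
    unfolding s_def
    using sum_le_suminf[OF sums_summable[OF Suc.IH], of "{..<N}"] sums_unique[OF Suc.IH] pos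
    by (simp add: less_imp_le del: power_Suc)
  have "summable a"
  proof (rule bounded_imp_summable[of _ "1 / y ^ Suc k / y"])
    fix N
    have "y * (\<Sum>n\<le>N. a n) \<le> s (Suc N)"
      using s[of "Suc N"] c_nonneg[of "Suc N"] by (simp add: lessThan_Suc_atMost)
    also note s_le
    finally show "(\<Sum>n\<le>N. a n) \<le> 1 / y ^ Suc k / y"
      using assms by (simp add: field_simps)
  qed (rule a_nonneg)
  then have a_lim: "(\<lambda>N. \<Sum>n<N. a n) \<longlonglongrightarrow> suminf a"
    by (rule summable_LIMSEQ)
  have "(\<lambda>N. s N - y * (\<Sum>n<N. a n)) \<longlonglongrightarrow> 1 / y ^ Suc k - y * suminf a"
    by (intro tendsto_intros s_lim a_lim)
  then have c_lim: "c \<longlonglongrightarrow> 1 / y ^ Suc k - y * suminf a"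
    by (simp add: s)
  have "summable (\<lambda>n. c n / (y + real n))"
    using \<open>summable a\<close> by (simp add: a_c [abs_def])
  then have "1 / y ^ Suc k - y * suminf a = 0"
    by (rule tendsto_0_if_summable_over_linear[OF c_lim c_nonneg assms])
  then have "suminf a = 1 / y ^ Suc (Suc k)"
    using assms by (simp add: field_simps)
  with summable_sums[OF \<open>summable a\<close>] show ?case
    by (simp only: a_def)
qed

section \<open>The bracketed terms as power series\<close>

text \<open>
  With \<open>t = x - 1\<close> and after multiplication by \<open>n!\<close>, the harmonic parts on the two sides differ
  by \<open>t\<^sup>n\<^sup>+\<^sup>1 / (n + 1)\<close> and the binomial sums by the remaining terms of
  \<open>(1 + t)\<^sup>n\<^sup>+\<^sup>1 / (n + 1)\<close>, which together are the inhomogeneity.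
\<close>

lemma P_Suc:
  "of_nat (Suc n) * P (Suc n) x = (x - 1) * P n x + x ^ Suc n / fact (Suc n)"
proof -
  define t where "t = x - 1"
  define Q where "Q = (\<lambda>n. \<Sum>j<n. of_nat (n choose j) * (t ^ j / of_nat (n - j)))"
  have coeff: "of_nat (Suc n choose Suc j) / of_nat (n - j) - of_nat (n choose j) / of_nat (n - j)
      = (of_nat (Suc n choose Suc j) / of_nat (Suc n) :: complex)" if "j < n" for j
  proof -
    have "(Suc n - Suc j) * (Suc n choose Suc j) = Suc n * (n choose Suc j)"
      using binomial_absorb_comp[of "Suc n" "Suc j"] by simp
    then have "of_nat (n - j) * of_nat (Suc n choose Suc j)
        = (of_nat (Suc n) * of_nat (n choose Suc j) :: complex)"
      by (metis diff_Suc_Suc of_nat_mult)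
    moreover have "of_nat (n - j) \<noteq> (0 :: complex)" "of_nat (Suc n) \<noteq> (0 :: complex)"
      using that by (simp_all del: of_nat_Suc)
    moreover have "of_nat (Suc n choose Suc j) = (of_nat (n choose j) + of_nat (n choose Suc j) :: complex)"
      by simp
    moreover have "D / d - A / d = D / m"
      if "d * D = m * B" "d \<noteq> 0" "m \<noteq> 0" "D = A + B" for d D m A B :: complex
    proof -
      have "D / d - A / d = B / d"
        using that(4) by (simp add: add_divide_distrib)
      also have "\<dots> = D / m"
        using that(1-3) by (simp add: frac_eq_eq mult.commute)
      finally show ?thesis .
    qed
    ultimately show ?thesis
      by blast
  qed
  have "Q (Suc n) = 1 / of_nat (Suc n) + (\<Sum>j<n. of_nat (Suc n choose Suc j) * (t ^ Suc j / of_nat (n - j)))"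
    unfolding Q_def by (subst sum.lessThan_Suc_shift) simp
  moreover have "t * Q n = (\<Sum>j<n. of_nat (n choose j) * (t ^ Suc j / of_nat (n - j)))"
    unfolding Q_def sum_distrib_left by (intro sum.cong) simp_all
  ultimately have "Q (Suc n) - t * Q n
      = 1 / of_nat (Suc n) + ((\<Sum>j<n. of_nat (Suc n choose Suc j) * (t ^ Suc j / of_nat (n - j)))
          - (\<Sum>j<n. of_nat (n choose j) * (t ^ Suc j / of_nat (n - j))))"
    by (simp only: add_diff_eq)
  also have "\<dots> = 1 / of_nat (Suc n) + (\<Sum>j<n. t ^ Suc j * (of_nat (Suc n choose Suc j) / of_nat (n - j)
          - of_nat (n choose j) / of_nat (n - j)))"
    unfolding sum_subtractf [symmetric]
    by (intro arg_cong2[where f = "(+)"] refl sum.cong)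
       (simp only: right_diff_distrib times_divide_eq_right mult.commute)
  also have "\<dots> = 1 / of_nat (Suc n) +
      (\<Sum>j<n. t ^ Suc j * (of_nat (Suc n choose Suc j) / of_nat (Suc n)))"
    by (intro arg_cong2[where f = "(+)"] refl sum.cong) (simp_all only: coeff lessThan_iff)
  also have "\<dots> + t ^ Suc n / of_nat (Suc n)
      = (\<Sum>j\<le>Suc n. of_nat (Suc n choose j) * t ^ j) / of_nat (Suc n)"
    by (subst sum.atMost_Suc, subst sum.atMost_shift)
       (simp add: sum_divide_distrib add_divide_distrib mult_ac of_nat_1 [unfolded One_nat_def] del: binomial_Suc_Suc of_nat_Suc)
  also have "(\<Sum>j\<le>Suc n. of_nat (Suc n choose j) * t ^ j) = x ^ Suc n"
    using binomial_ring[of t 1 "Suc n"] by (simp add: t_def del: power_Suc)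
  finally have Q: "Q (Suc n) + t ^ Suc n / of_nat (Suc n) = t * Q n + x ^ Suc n / of_nat (Suc n)"
    by (simp add: algebra_simps)
  have harm_Q: "harm (Suc n) * t ^ Suc n + Q (Suc n) = t * (harm n * t ^ n + Q n) + x ^ Suc n / of_nat (Suc n)"
    using Q by (simp add: harm_Suc field_simps del: of_nat_Suc)
  have "of_nat (Suc n) * P (Suc n) x = (harm (Suc n) * t ^ Suc n + Q (Suc n)) / fact n"
    by (simp add: P_def Q_def t_def field_simps del: of_nat_Suc)
  also have "\<dots> = t * ((harm n * t ^ n + Q n) / fact n) + x ^ Suc n / fact (Suc n)"
    unfolding harm_Q by (subst add_divide_distrib) (simp del: of_nat_Suc power_Suc)
  also have "(harm n * t ^ n + Q n) / fact n = P n x"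
    by (simp add: P_def Q_def t_def)
  finally show ?thesis
    by (simp only: t_def)
qed

text \<open>
  The polynomial \<open>P\<^sub>n\<close> cancels the powers up to \<open>x\<^sup>n\<close> in the expansion at \<open>0\<close> of the logarithmic
  term, so that the remainder begins with \<open>x\<^sup>n\<^sup>+\<^sup>1\<close>.
\<close>

definition log_remainder :: "nat \<Rightarrow> complex \<Rightarrow> complex" where
  "log_remainder n x = P n x + (-1) powi (int n - 1) / fact n * (1 - x) ^ n * Ln (1 - x)"

lemma log_remainder_0: "log_remainder 0 x = - Ln (1 - x)"
  by (simp add: log_remainder_def P_def harm_def power_int_minus)

lemma log_remainder_Suc:
  "of_nat (Suc n) * log_remainder (Suc n) x = (x - 1) * log_remainder n x + x ^ Suc n / fact (Suc n)"
proof -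
  have "of_nat (Suc n) * ((-1) powi (int (Suc n) - 1) / fact (Suc n) * (1 - x) ^ Suc n * Ln (1 - x))
      = (x - 1) * ((-1) powi (int n - 1) / fact n * (1 - x) ^ n * Ln (1 - x))"
  proof -
    have "(-1 :: complex) powi (int n - 1) = - ((-1) ^ n)"
      by (simp add: power_int_diff)
    moreover have "(-1 :: complex) powi (int (Suc n) - 1) = (-1) ^ n"
      by simp
    ultimately show ?thesis
      by (simp add: field_simps del: of_nat_Suc)
  qed
  then show ?thesis
    unfolding log_remainder_def using P_Suc[of n x] by (simp add: algebra_simps del: of_nat_Suc power_Suc fact_Suc)
qed

text \<open>
  Dividing \<open>1 / (m)\<^sub>n\<^sub>+\<^sub>1 - 1 / (m + 1)\<^sub>n\<^sub>+\<^sub>1\<close> by \<open>n + 1\<close> gives \<open>1 / (m)\<^sub>n\<^sub>+\<^sub>2\<close>, so \<open>n + 1\<close>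
  times the series for \<open>n + 1\<close> is the series for \<open>n\<close> minus \<open>1 / x\<close> times the same series without
  its first term. That first term is \<open>x / (n + 1)!\<close>, which matches the recurrence of
  \<open>log_remainder\<close>.
\<close>

lemma log_remainder_sums:
  assumes "x \<noteq> 0" and "norm x < 1"
  shows "(\<lambda>m. x ^ Suc m / pochhammer (of_nat (Suc m)) (Suc n)) sums (log_remainder n x / x ^ n)"
proof (induction n)
  case 0
  have "(\<lambda>m. x ^ m / of_nat m) sums (- Ln (1 - x))"
    using sums_minus[OF Ln_series'[of "- x"]] assms by simp
  then have "(\<lambda>m. x ^ Suc m / of_nat (Suc m)) sums (- Ln (1 - x))"
    by (subst sums_Suc_iff) simp
  then show ?case
    by (simp add: log_remainder_0)
next
  case (Suc n)
  define f where "f = (\<lambda>m. x ^ m / pochhammer (of_nat m) (Suc n))"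
  have f: "(\<lambda>m. f (Suc m)) sums (log_remainder n x / x ^ n)"
    using Suc.IH by (simp add: f_def)
  have "f (Suc 0) = x / fact (Suc n)"
    by (simp add: f_def pochhammer_fact)
  then have "(\<lambda>m. f (Suc (Suc m))) sums (log_remainder n x / x ^ n - x / fact (Suc n))"
    using f by (subst sums_Suc_iff) simp
  then have "(\<lambda>m. f (Suc (Suc m)) / x) sums ((log_remainder n x / x ^ n - x / fact (Suc n)) / x)"
    by (rule sums_divide)
  from sums_divide[OF sums_diff[OF f this], of "of_nat (Suc n)"]
  have "(\<lambda>m. (f (Suc m) - f (Suc (Suc m)) / x) / of_nat (Suc n)) sums
      ((log_remainder n x / x ^ n - (log_remainder n x / x ^ n - x / fact (Suc n)) / x) / of_nat (Suc n))" .
  moreover have "(f (Suc m) - f (Suc (Suc m)) / x) / of_nat (Suc n)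
      = x ^ Suc m / pochhammer (of_nat (Suc m)) (Suc (Suc n))" for m
  proof -
    define p :: complex where "p = pochhammer (of_nat (Suc (Suc m))) n"
    define q :: complex where "q = of_nat (Suc m)"
    define r :: complex where "r = of_nat (Suc n)"
    have qr: "q + r \<noteq> 0" "q \<noteq> 0" "r \<noteq> 0"
      by (simp_all add: q_def r_def of_nat_add [symmetric] del: of_nat_Suc of_nat_add)
    have p0: "p \<noteq> 0"
      by (auto simp: p_def pochhammer_eq_0_iff simp del: of_nat_Suc) (metis add_eq_0_iff2 nat.simps(3) of_nat_eq_0_iff of_nat_add add_is_0)
    have 1: "pochhammer q (Suc n) = q * p"
      by (simp add: q_def p_def pochhammer_rec add_ac)
    have 2: "pochhammer (of_nat (Suc (Suc m))) (Suc n) = p * (q + r)"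
      by (simp add: pochhammer_Suc p_def q_def r_def)
    have 3: "pochhammer q (Suc (Suc n)) = q * p * (q + r)"
      by (simp only: pochhammer_Suc[of q "Suc n"] 1 r_def)
    show ?thesis
      unfolding f_def 2 q_def[symmetric] r_def[symmetric] 1 3
    proof -
      have "(x ^ Suc m / (q * p) - x ^ Suc (Suc m) / (p * (q + r)) / x) / r
          = x ^ Suc m * (1 / (q * p) - 1 / (p * (q + r))) / r"
        using assms by (simp add: right_diff_distrib)
      also have "1 / (q * p) - 1 / (p * (q + r)) = r / (q * p * (q + r))"
        using qr p0 by (simp add: divide_simps)
      finally show "(x ^ Suc m / (q * p) - x ^ Suc (Suc m) / (p * (q + r)) / x) / r
          = x ^ Suc m / (q * p * (q + r))"
        using qr by simp
    qed
  qed
  moreover have "(log_remainder n x / x ^ n - (log_remainder n x / x ^ n - x / fact (Suc n)) / x) / of_nat (Suc n)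
      = log_remainder (Suc n) x / x ^ Suc n"
  proof -
    define r :: complex where "r = of_nat (Suc n)"
    define F :: complex where "F = fact (Suc n)"
    have r: "r \<noteq> 0" and F: "F \<noteq> 0" 
      by (simp_all add: r_def F_def del: of_nat_Suc fact_Suc)
    have "log_remainder (Suc n) x = ((x - 1) * log_remainder n x + x ^ Suc n / F) / r"
      using log_remainder_Suc[of n x] r unfolding r_def[symmetric] F_def[symmetric]
      by (simp add: field_simps)
    moreover have "(L / X - (L / X - x / F) / x) / r = ((x - 1) * L + x * X / F) / r / (x * X)"
      if "X \<noteq> 0" for L X
      using assms that r F by (simp add: divide_simps) (simp add: algebra_simps)
    ultimately show ?thesis
      unfolding r_def[symmetric] F_def[symmetric] using assms by simp
  qed
  ultimately show ?case by simp
qed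

section \<open>Interchange of summation\<close>

text \<open>
  The factor \<open>u m n\<close> below does not involve \<open>x\<close> and is nonnegative, so the row sums of the norms
  are known exactly and are dominated by a geometric series.
\<close>

lemma stirling_log_remainder_sums:
  assumes "x \<noteq> 0" and "norm x < 1"
  shows "(\<lambda>n. of_nat (stirling n k) * (log_remainder n x / x ^ n)) sums
         (\<Sum>m. x ^ Suc m / of_nat (Suc m) ^ Suc k)"
proof -
  define f :: "nat \<Rightarrow> nat \<Rightarrow> complex" where
    "f = (\<lambda>m n. of_nat (stirling n k) * (x ^ Suc m / pochhammer (of_nat (Suc m)) (Suc n)))"
  define u :: "nat \<Rightarrow> nat \<Rightarrow> real" where
    "u = (\<lambda>m n. of_nat (stirling n k) / pochhammer (of_nat (Suc m)) (Suc n))"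
  have u_nonneg: "u m n \<ge> 0" for m n
    using pochhammer_pos[of "real (Suc m)" "Suc n"] by (simp add: u_def del: of_nat_Suc)
  have u_sum: "u m sums (1 / real (Suc m) ^ Suc k)" for m
    unfolding u_def by (rule stirling_over_pochhammer_sums) simp
  have f_u: "f m n = x ^ Suc m * of_real (u m n)" for m n
  proof -
    have "pochhammer (of_nat (Suc m)) (Suc n) = complex_of_real (pochhammer (real (Suc m)) (Suc n))"
      using pochhammer_of_real[of "real (Suc m)" "Suc n", where 'a = complex]
      by (simp only: of_real_of_nat_eq)
    then show ?thesis
      by (simp add: f_def u_def del: of_nat_Suc)
  qed
  have norm_f: "norm (f m n) = norm x ^ Suc m * u m n" for m n
    using u_nonneg[of m n] by (simp add: f_u norm_mult norm_power)
  have f_row: "f m sums (x ^ Suc m / of_nat (Suc m) ^ Suc k)" for m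
  proof -
    have "(\<lambda>n. x ^ Suc m * of_real (u m n)) sums (x ^ Suc m * of_real (1 / real (Suc m) ^ Suc k))"
      by (intro sums_mult sums_of_real u_sum)
    moreover have "f m = (\<lambda>n. x ^ Suc m * of_real (u m n))"
      by (simp only: fun_eq_iff f_u simp_thms)
    ultimately show ?thesis
      by (simp del: of_nat_Suc power_Suc)
  qed
  have f_col: "(\<lambda>m. f m n) sums (of_nat (stirling n k) * (log_remainder n x / x ^ n))" for n
    unfolding f_def by (intro sums_mult log_remainder_sums assms)
  have norm_row: "((\<lambda>n. norm (f m n)) has_sum (norm x ^ Suc m / real (Suc m) ^ Suc k)) UNIV" for m
  proof -
    have "(\<lambda>n. norm (f m n)) sums (norm x ^ Suc m * (1 / real (Suc m) ^ Suc k))"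
      unfolding norm_f by (intro sums_mult u_sum)
    then have "(\<lambda>n. norm (f m n)) sums (norm x ^ Suc m / real (Suc m) ^ Suc k)"
      by (simp only: times_divide_eq_right mult_1_right)
    then show ?thesis
      by (rule sums_nonneg_imp_has_sum) (rule norm_ge_zero)
  qed
  have "(\<lambda>m. norm x ^ Suc m / real (Suc m) ^ Suc k) summable_on UNIV"
  proof (rule summable_nonneg_imp_summable_on)
    show "summable (\<lambda>m. norm x ^ Suc m / real (Suc m) ^ Suc k)"
    proof (rule summable_comparison_test')
      show "summable (\<lambda>m. norm x ^ Suc m)"
        using assms by (simp add: summable_geometric summable_mult)
      fix m :: nat
      have "1 \<le> real (Suc m) ^ Suc k" by (rule one_le_power) simp
      then have "norm x ^ Suc m / real (Suc m) ^ Suc k \<le> norm x ^ Suc m / 1"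
        by (intro divide_left_mono) (simp_all del: power_Suc)
      then show "norm (norm x ^ Suc m / real (Suc m) ^ Suc k) \<le> norm x ^ Suc m"
        by (simp del: power_Suc of_nat_Suc)
    qed
  qed simp
  then have norm_f_summable: "(\<lambda>(m, n). norm (f m n)) summable_on (UNIV \<times> UNIV)"
    using norm_row
    by (intro summable_on_SigmaI[where g = "\<lambda>m. norm x ^ Suc m / real (Suc m) ^ Suc k"])
       (simp_all del: of_nat_Suc power_Suc)
  then have "(\<lambda>p. norm ((\<lambda>(m, n). f m n) p)) summable_on (UNIV \<times> UNIV)"
    by (simp only: case_prod_unfold)
  then have "(\<lambda>(m, n). f m n) summable_on (UNIV \<times> UNIV)"
    by (rule abs_summable_summable)
  then obtain S where S: "((\<lambda>(m, n). f m n) has_sum S) (UNIV \<times> UNIV)"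
    unfolding summable_on_def by blast
  have row: "(f m has_sum (x ^ Suc m / of_nat (Suc m) ^ Suc k)) UNIV" for m
    using has_sum_imp_sums[OF norm_row, THEN sums_summable] f_row
    by (rule norm_summable_imp_has_sum)
  have norm_col: "summable (\<lambda>m. norm (f m n))" for n
  proof -
    have "(\<lambda>(n, m). norm (f m n)) summable_on (UNIV \<times> UNIV)"
      using summable_on_swap[THEN iffD1, OF norm_f_summable] by (simp only: prod.case)
    then show ?thesis
      by (intro summable_on_imp_summable, rule summable_on_SigmaD1) simp
  qed
  have col: "((\<lambda>m. f m n) has_sum (of_nat (stirling n k) * (log_remainder n x / x ^ n))) UNIV" for n
    using norm_col f_col by (rule norm_summable_imp_has_sum)
  have "((\<lambda>m. x ^ Suc m / of_nat (Suc m) ^ Suc k) has_sum S) UNIV"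
    by (rule has_sum_SigmaD[OF S]) (simp only: prod.case row)
  then have S_eq: "S = (\<Sum>m. x ^ Suc m / of_nat (Suc m) ^ Suc k)"
    by (intro sums_unique has_sum_imp_sums)
  have "((\<lambda>(n, m). f m n) has_sum S) (UNIV \<times> UNIV)"
    using has_sum_swap[THEN iffD1, OF S] by (simp only: prod.case)
  then have "((\<lambda>n. of_nat (stirling n k) * (log_remainder n x / x ^ n)) has_sum S) UNIV"
    by (rule has_sum_SigmaD) (simp only: prod.case col)
  then show ?thesis
    unfolding S_eq by (rule has_sum_imp_sums)
qed

lemma polylog_of_nat:
  "polylog (of_nat k) x = (\<Sum>m. x ^ Suc m / of_nat (Suc m) ^ k)"
  unfolding polylog_def
  by (intro suminf_cong) (simp add: powr_nat' del: of_nat_Suc power_Suc)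

theorem theorem4:
  fixes k :: nat and x :: complex
  assumes "0 < norm x" and "norm x < 1"
  shows "(\<lambda>i. let n = k + i in
            of_nat (stirling n k) * (1 / x ^ n) *
              (P n x + (-1) powi (int n - 1) / fact n * (1 - x) ^ n * Ln (1 - x)))
         sums polylog (of_nat (k + 1)) x"
proof -
  have "(\<lambda>n. of_nat (stirling n k) * (log_remainder n x / x ^ n)) sums polylog (of_nat (Suc k)) x"
    unfolding polylog_of_nat using assms by (intro stirling_log_remainder_sums) auto
  \<comment> \<open>The terms with \<open>n < k\<close> vanish.\<close>
  then have "(\<lambda>i. of_nat (stirling (i + k) k) * (log_remainder (i + k) x / x ^ (i + k)))
      sums polylog (of_nat (Suc k)) x"
    by (subst sums_zero_iff_shift) auto
  then show ?thesis
    by (simp add: log_remainder_def Let_def add.commute mult.assoc del: of_nat_Suc)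
qed

end
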